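(* There is an absolute constant $c>0$ such that for every martingale difference $\Phi=\{\phi_k:\ k=1,2,\ldots\}\subset L^2(0,1)$ consisting of nonzero functions, and every integer $n\ge 2$, $$\mathcal K_n(\Phi)\le c\,\sqrt{\log n}.$$
   Context: Functions are real-valued, on $[0,1)$ with Lebesgue measure; $\log$ has base $2$. A partition of $[0,1)$ is a (finite or infinite) sequence of pairwise disjoint measurable sets with union $[0,1)$. A filtration is a sequence $\mathcal A_n$, $n=1,2,\ldots$, of partitions of $[0,1)$ such that every $A\in\mathcal A_n$ is a union of some sets from $\mathcal A_{n+1}$ (called children of $A$). A martingale difference based on a filtration $\{\mathcal A_n\}$ is a sequence of functions $f_n\in L^1(0,1)$, $n=1,2,\ldots$, such that (1) $f_n$ is constant on each $A\in\mathcal A_n$; (2) $\int_A f_n=0$ for every $A\in\mathcal A_{n-1}$, $n\ge2$. A martingale difference is such a sequence for some filtration. If it lies in $L^2(0,1)$, it is an orthogonal system. For an infinite orthogonal system $\Phi=\{\phi_k\}_{k\ge1}\subset L^2(0,1)$ of nonzero functions, let $\mathcal P_n(\Phi)$ be the family of all monotonic sequences of $\Phi$-polynomials, i.e. all $n$-tuples $(p_1,\ldots,p_n)$ of the form $p_k=\sum_{j\in G_k}c_j\phi_j$, $k=1,\ldots,n$, where $G_1\subset G_2\subset\cdots\subset G_n\subset\mathbb N$ are finite sets, the real coefficients $c_j$ do not depend on $k$, and $\sum_{j\in G_n}c_j^2\ne0$. Define $$\mathcal K_n(\Phi)=\sup_{\{p_k\}\in\mathcal P_n(\Phi)}\frac{\left\|\max_{1\le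 m\le n}|p_m|\right\|_2}{\|p_n\|_2}.$$ *)

theory Defs
  imports "HOL-Analysis.Analysis"
begin

abbreviation unit_leb :: "real measure"
  where "unit_leb \<equiv> lebesgue_on {0..<1}"

text \<open>Functions on \<open>[0,1)\<close> are total functions on the reals, of which only the restriction to
  \<open>[0,1)\<close> matters. Sequences of functions and of partitions are indexed from \<open>0\<close> instead of \<open>1\<close>.\<close>

definition L1_unit :: "(real \<Rightarrow> real) set"
  where "L1_unit = {f. integrable unit_leb f}"

definition L2_unit :: "(real \<Rightarrow> real) set"
  where "L2_unit = {f \<in> borel_measurable unit_leb. integrable unit_leb (\<lambda>x. (f x)\<^sup>2)}"

definition L2_unit_norm :: "(real \<Rightarrow> real) \<Rightarrow> real"
  where "L2_unit_norm f = sqrt (\<integral>x. (f x)\<^sup>2 \<partial>unit_leb)"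

text \<open>A finite or infinite sequence of pairwise disjoint sets is represented by the countable set
  of its terms; only the empty set could be repeated in such a sequence.\<close>

definition unit_partition :: "real set set \<Rightarrow> bool"
  where "unit_partition P \<longleftrightarrow>
    countable P \<and> P \<subseteq> sets unit_leb \<and> disjoint P \<and> \<Union>P = {0..<1}"

definition unit_filtration :: "(nat \<Rightarrow> real set set) \<Rightarrow> bool"
  where "unit_filtration \<A> \<longleftrightarrow>
    (\<forall>n. unit_partition (\<A> n)) \<and> (\<forall>n. \<forall>A\<in>\<A> n. \<exists>C\<subseteq>\<A> (Suc n). A = \<Union>C)"

text \<open>Functions in \<open>L\<^sup>1\<close> are identified when they agree almost everywhere, so constancy on a set
  means constancy almost everywhere on it. The integral of the first function is unrestricted.\<close>

definition martingale_difference_on ::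
    "(nat \<Rightarrow> real set set) \<Rightarrow> (nat \<Rightarrow> real \<Rightarrow> real) \<Rightarrow> bool"
  where "martingale_difference_on \<A> f \<longleftrightarrow>
    (\<forall>n. f n \<in> L1_unit) \<and>
    (\<forall>n. \<forall>A\<in>\<A> n. \<exists>a. AE x in unit_leb. x \<in> A \<longrightarrow> f n x = a) \<and>
    (\<forall>n. \<forall>A\<in>\<A> n. (LINT x:A|unit_leb. f (Suc n) x) = 0)"

definition martingale_difference :: "(nat \<Rightarrow> real \<Rightarrow> real) \<Rightarrow> bool"
  where "martingale_difference f \<longleftrightarrow>
    (\<exists>\<A>. unit_filtration \<A> \<and> martingale_difference_on \<A> f)"

text \<open>The tuple \<open>(p\<^sub>1, \<dots>, p\<^sub>n)\<close> consists of the values of \<open>p\<close> on \<open>{1..n}\<close>; its other values are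
  arbitrary.\<close>

definition monotonic_polys ::
    "(nat \<Rightarrow> real \<Rightarrow> real) \<Rightarrow> nat \<Rightarrow> (nat \<Rightarrow> real \<Rightarrow> real) set"
  where "monotonic_polys \<Phi> n = {p. \<exists>(G :: nat \<Rightarrow> nat set) (c :: nat \<Rightarrow> real).
    (\<forall>k\<in>{1..n}. finite (G k)) \<and>
    (\<forall>k\<in>{1..<n}. G k \<subseteq> G (Suc k)) \<and>
    (\<Sum>j\<in>G n. (c j)\<^sup>2) \<noteq> 0 \<and>
    (\<forall>k\<in>{1..n}. p k = (\<lambda>x. \<Sum>j\<in>G k. c j * \<Phi> j x))}"

text \<open>For an orthogonal system of nonzero functions the denominator is positive. The supremum is
  taken in the extended reals.\<close>

definition maximal_const :: "nat \<Rightarrow> (nat \<Rightarrow> real \<Rightarrow> real) \<Rightarrow> ereal"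
  where "maximal_const n \<Phi> = (SUP p\<in>monotonic_polys \<Phi> n.
    ereal (L2_unit_norm (\<lambda>x. MAX m\<in>{1..n}. \<bar>p m x\<bar>) / L2_unit_norm (p n)))"

end

theory Submission
  imports Defs
begin

text \<open>The space \<open>\<ell>\<^sup>p\<close> is 2-smooth: \<open>\<parallel>u + y\<parallel>\<^sup>2 \<le> \<parallel>u\<parallel>\<^sup>2 + D(u)(y) + (p - 1) \<parallel>y\<parallel>\<^sup>2\<close>, where \<open>D(u)\<close> is the
  derivative of the squared norm at \<open>u\<close>. For \<open>p\<close> about \<open>2 log n\<close> the norm of \<open>\<ell>\<^sup>p\<close> on \<open>n\<close> coordinates is
  equivalent to the maximum norm, with absolute constants. The tuple of polynomials is a martingale
  with values in this space, whose \<open>j\<close>-th increment has all coordinates equal to \<open>c\<^sub>j \<phi>\<^sub>j\<close> or \<open>0\<close>.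
  Integrating the smoothness inequality along it, the first-order terms vanish, and the remaining
  terms add up to a multiple \<open>O(log n)\<close> of \<open>\<parallel>p\<^sub>n\<parallel>\<^sup>2\<close> by orthogonality.\<close>

section \<open>Smoothness of the power norms\<close>

text \<open>Young's inequality with integer exponents. The induction step multiplies the hypothesis
  by \<open>w\<close> and adds the rearrangement inequality for \<open>w\<close>, \<open>r\<close>
  and their powers.\<close>

lemma weighted_power_mean_le:
  fixes w r :: real
  assumes "0 \<le> w" "0 \<le> r"
  shows "real (Suc k) * w ^ k * r \<le> real k * w ^ Suc k + r ^ Suc k"
proof (induction k)
  case 0
  then show ?case by simp
next
  case (Suc k)
  have "0 \<le> (w ^ Suc k - r ^ Suc k) * (w - r)"
  proof (cases "r \<le> w")
    case True
    then show ?thesis using power_mono[OF True assms(2)]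
      by (intro mult_nonneg_nonneg) (auto simp del: power_Suc)
  next
    case False
    then have "w \<le> r" by simp
    then show ?thesis using power_mono[OF \<open>w \<le> r\<close> assms(1)]
      by (intro mult_nonpos_nonpos) (auto simp del: power_Suc)
  qed
  moreover have "w * (real (Suc k) * w ^ k * r) \<le> w * (real k * w ^ Suc k + r ^ Suc k)"
    using Suc assms by (intro mult_left_mono)
  ultimately show ?case by (simp add: algebra_simps)
qed

lemma second_order_upper_bound:
  fixes g g' g'' :: "real \<Rightarrow> real"
  assumes "\<And>t. (g has_real_derivative g' t) (at t)"
    and "\<And>t. (g' has_real_derivative g'' t) (at t)"
    and "\<And>t. g'' t \<le> 2 * K"
  shows "g 1 \<le> g 0 + g' 0 + K"
proof -
  define diff where "diff m = (if m = 0 then g else if m = 1 then g' else g'')" for m :: nat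
  have "\<exists>t>0. t < 1 \<and> g 1 = (\<Sum>m<2. diff m 0 / fact m * 1 ^ m) + diff 2 t / fact 2 * 1 ^ 2"
    using assms(1,2) by (intro Maclaurin) (auto simp: diff_def less_2_cases_iff)
  then obtain t where "g 1 = g 0 + g' 0 + g'' t / 2"
    by (auto simp: diff_def numeral_2_eq_2)
  then show ?thesis using assms(3)[of t] by simp
qed

text \<open>\<open>smooth_max\<close> is the squared \<open>\<ell>\<^sup>2\<^sup>q\<close> norm; a positive \<open>\<epsilon>\<close> keeps it smooth at the origin.\<close>

definition smooth_sum :: "real \<Rightarrow> nat \<Rightarrow> 'i set \<Rightarrow> ('i \<Rightarrow> real) \<Rightarrow> real"
  where "smooth_sum \<epsilon> q I u = \<epsilon> ^ q + (\<Sum>m\<in>I. u m ^ (2 * q))"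

definition smooth_max :: "real \<Rightarrow> nat \<Rightarrow> 'i set \<Rightarrow> ('i \<Rightarrow> real) \<Rightarrow> real"
  where "smooth_max \<epsilon> q I u = smooth_sum \<epsilon> q I u powr (1 / real q)"

text \<open>The partial derivative of \<open>smooth_max\<close> in coordinate \<open>m\<close>: the
  outer factor \<open>1 / q\<close> has cancelled against the \<open>2 * q\<close> coming from the
  power.\<close>

definition smooth_max_deriv :: "real \<Rightarrow> nat \<Rightarrow> 'i set \<Rightarrow> ('i \<Rightarrow> real) \<Rightarrow> 'i \<Rightarrow> real"
  where "smooth_max_deriv \<epsilon> q I u m =
    2 * smooth_sum \<epsilon> q I u powr (1 / real q - 1) * u m ^ (2 * q - 1)"

section \<open>Elementary bounds for the smoothed norm\<close>

lemma smooth_sum_pos: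
  assumes "0 < \<epsilon>"
  shows "0 < smooth_sum \<epsilon> q I u"
  using assms unfolding smooth_sum_def
  by (intro add_pos_nonneg sum_nonneg) (auto simp: power_mult)

lemma smooth_max_pos:
  assumes "0 < \<epsilon>"
  shows "0 < smooth_max \<epsilon> q I u"
  using smooth_sum_pos[OF assms, of q I u] by (simp add: smooth_max_def)

lemma smooth_max_power:
  assumes "0 < \<epsilon>" "0 < q"
  shows "smooth_max \<epsilon> q I u ^ q = smooth_sum \<epsilon> q I u"
  using smooth_sum_pos[OF assms(1), of q I u] assms(2)
  by (simp add: smooth_max_def powr_realpow[symmetric] powr_powr)

text \<open>Normalises the derivatives: with \<open>smooth_max\<close> equal to
  \<open>smooth_sum\<close> to the power \<open>1 / q\<close>, the two exponents of
  \<open>smooth_sum\<close> are opposite.\<close>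

lemma smooth_max_power_pred:
  assumes "0 < \<epsilon>" "0 < q"
  shows "smooth_sum \<epsilon> q I u powr (1 / real q - 1) * smooth_max \<epsilon> q I u ^ (q - 1) = 1"
proof -
  have "smooth_max \<epsilon> q I u ^ (q - 1) = smooth_sum \<epsilon> q I u powr (1 / real q * real (q - 1))"
    using smooth_sum_pos[OF assms(1), of q I u]
    by (simp add: smooth_max_def powr_realpow[symmetric] powr_powr)
  moreover have "1 / real q * real (q - 1) = - (1 / real q - 1)"
    using assms(2) by (simp add: field_simps of_nat_diff)
  ultimately show ?thesis
    using smooth_sum_pos[OF assms(1), of q I u] by (simp add: powr_add[symmetric])
qed

lemma smooth_max_zero:
  assumes "0 < \<epsilon>" "0 < q"
  shows "smooth_max \<epsilon> q I (\<lambda>_. 0) = \<epsilon>"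
  using assms by (simp add: smooth_max_def smooth_sum_def power_0_left powr_realpow[symmetric] powr_powr)

lemma square_le_smooth_max:
  assumes "0 < \<epsilon>" "0 < q" "finite I" "m \<in> I"
  shows "(u m)\<^sup>2 \<le> smooth_max \<epsilon> q I u"
proof -
  have "((u m)\<^sup>2) ^ q \<le> (\<Sum>m\<in>I. u m ^ (2 * q))"
    using assms(3,4) member_le_sum[of m I "\<lambda>m. u m ^ (2 * q)"] by (auto simp: power_mult)
  also have "\<dots> \<le> smooth_max \<epsilon> q I u ^ q"
    using assms(1) by (simp add: smooth_max_power[OF assms(1,2)] smooth_sum_def)
  finally show ?thesis
    using smooth_max_pos[OF assms(1), of q I u] power_mono_iff[of "(u m)\<^sup>2" "smooth_max \<epsilon> q I u" q]
      assms(2)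
    by simp
qed

text \<open>Splitting off one factor \<open>u m\<close> leaves \<open>q - 1\<close> factors
  \<open>(u m)\<^sup>2\<close>, each at most \<open>smooth_max\<close>; the negative power of
  \<open>smooth_sum\<close> cancels them. This linear growth later makes the derivative of a
  square-integrable martingale square-integrable.\<close>

lemma abs_smooth_max_deriv_le:
  assumes "0 < \<epsilon>" "0 < q" "finite I" "m \<in> I"
  shows "\<bar>smooth_max_deriv \<epsilon> q I u m\<bar> \<le> 2 * \<bar>u m\<bar>"
proof -
  have "2 * q - 1 = Suc (2 * (q - 1))" using assms(2) by simp
  then have eq: "u m ^ (2 * q - 1) = u m * ((u m)\<^sup>2) ^ (q - 1)"
    by (simp add: power_mult)
  have "((u m)\<^sup>2) ^ (q - 1) \<le> smooth_max \<epsilon> q I u ^ (q - 1)"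
    by (intro power_mono square_le_smooth_max assms) simp
  then have "smooth_sum \<epsilon> q I u powr (1 / real q - 1) * ((u m)\<^sup>2) ^ (q - 1) \<le> 1"
    using smooth_max_power_pred[OF assms(1,2), of I u]
    by (metis mult_left_mono powr_ge_zero)
  then have "(2 * \<bar>u m\<bar>) * (smooth_sum \<epsilon> q I u powr (1 / real q - 1) * ((u m)\<^sup>2) ^ (q - 1))
      \<le> (2 * \<bar>u m\<bar>) * 1"
    by (intro mult_left_mono) auto
  then show ?thesis
    unfolding smooth_max_deriv_def eq by (simp add: abs_mult mult_ac)
qed

text \<open>A Hoelder-type bound whose factor \<open>card I\<close> to the power
  \<open>1 / q\<close> is at most 2. It is obtained by summing Young's inequality over
  \<open>I\<close>, and keeps the second-order constant linear in \<open>q\<close>.\<close>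

lemma sum_power_pred_le_smooth_max:
  assumes "0 < \<epsilon>" "0 < q" "finite I" "card I \<le> 2 ^ q"
  shows "(\<Sum>m\<in>I. u m ^ (2 * (q - 1))) \<le> 2 * smooth_max \<epsilon> q I u ^ (q - 1)"
proof -
  obtain k where q: "q = Suc k" using assms(2) by (cases q) auto
  \<comment> \<open>Halving makes the \<open>card I\<close> copies of \<open>r ^ q\<close> add up to
    at most \<open>smooth_max ^ q\<close>, which is \<open>smooth_sum\<close>.\<close>
  define r where "r = smooth_max \<epsilon> q I u / 2"
  have r: "0 < r" using smooth_max_pos[OF assms(1), of q I u] by (simp add: r_def)
  have "real q * r * (\<Sum>m\<in>I. u m ^ (2 * k)) = (\<Sum>m\<in>I. real (Suc k) * ((u m)\<^sup>2) ^ k * r)"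
    by (simp only: sum_distrib_left q power_mult) (simp add: mult_ac)
  also have "\<dots> \<le> (\<Sum>m\<in>I. real k * ((u m)\<^sup>2) ^ Suc k + r ^ Suc k)"
    using r by (intro sum_mono weighted_power_mean_le) auto
  also have "\<dots> = real k * (\<Sum>m\<in>I. u m ^ (2 * q)) + real (card I) * r ^ q"
    by (simp only: sum.distrib sum_distrib_left[symmetric] sum_constant q power_mult)
  also have "\<dots> \<le> real k * smooth_sum \<epsilon> q I u + real (2 ^ q) * r ^ q"
    using assms r by (intro add_mono mult_left_mono mult_right_mono)
      (auto simp: smooth_sum_def simp del: of_nat_power)
  also have "real (2 ^ q) * r ^ q = smooth_sum \<epsilon> q I u"
    by (simp add: r_def smooth_max_power[OF assms(1,2)] power_divide)
  also have "real k * smooth_sum \<epsilon> q I u + smooth_sum \<epsilon> q I u = real q * r * (2 * smooth_max \<epsilon> q I u ^ k)"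
    using smooth_max_power[OF assms(1,2), of I u] by (simp add: q r_def algebra_simps)
  finally show ?thesis
    using r assms(2) by (simp add: q mult_le_cancel_left del: of_nat_Suc)
qed

text \<open>Taylor expansion to second order along the segment from \<open>u\<close> to
  \<open>u + y\<close>. The increment is measured in the maximum norm only, because all coordinates
  of a martingale increment share one bound.\<close>

lemma smooth_max_two_smooth:
  assumes "0 < \<epsilon>" "0 < q" "finite I" "card I \<le> 2 ^ q" "\<And>m. m \<in> I \<Longrightarrow> \<bar>y m\<bar> \<le> b"
  shows "smooth_max \<epsilon> q I (\<lambda>m. u m + y m) \<le>
    smooth_max \<epsilon> q I u + (\<Sum>m\<in>I. smooth_max_deriv \<epsilon> q I u m * y m) + real (4 * q - 2) * b\<^sup>2"
proof -
  define S where "S t = smooth_sum \<epsilon> q I (\<lambda>m. u m + t * y m)" for t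
  define S' where "S' t = (\<Sum>m\<in>I. real (2 * q) * (u m + t * y m) ^ (2 * q - 1) * y m)" for t
  define S'' where "S'' t =
    (\<Sum>m\<in>I. real (2 * q) * (real (2 * q - 1) * (u m + t * y m) ^ (2 * q - 2) * y m) * y m)" for t
  define g where "g t = smooth_max \<epsilon> q I (\<lambda>m. u m + t * y m)" for t
  define g' where "g' t = (1 / real q) * (S t powr (1 / real q - 1) * S' t)" for t
  define g'' where "g'' t =
    (1 / real q) * ((1 / real q - 1) * S t powr (1 / real q - 1 - 1) * S' t * S' t
     + S t powr (1 / real q - 1) * S'' t)" for t
  have S_pos: "0 < S t" for t
    by (simp add: S_def smooth_sum_pos assms(1))
  have dS: "(S has_real_derivative S' t) (at t)" for t
    unfolding S_def smooth_sum_def S'_def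
    by (auto intro!: derivative_eq_intros sum.cong simp: mult_ac)
  have dS': "(S' has_real_derivative S'' t) (at t)" for t
    unfolding S'_def S''_def
    by (auto intro!: derivative_eq_intros sum.cong simp: mult_ac numeral_2_eq_2)
  have dpow: "((\<lambda>t. S t powr c) has_real_derivative c * S t powr (c - 1) * S' t) (at t)" for c t :: real
    using DERIV_fun_powr[OF dS S_pos] by simp
  have dg: "(g has_real_derivative g' t) (at t)" for t
    using dpow[of "1 / real q"] by (simp add: g_def[abs_def] g'_def smooth_max_def S_def[abs_def])
  have dg': "(g' has_real_derivative g'' t) (at t)" for t
    unfolding g'_def[abs_def] g''_def
    by (rule DERIV_cong[OF DERIV_cmult[OF DERIV_mult[OF dpow dS']]]) simp
  have bound: "g'' t \<le> 2 * (real (4 * q - 2) * b\<^sup>2)" for t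
  proof -
    let ?v = "\<lambda>m. u m + t * y m"
    \<comment> \<open>The outer power \<open>1 / q\<close> is concave, so the term with the squared
      first derivative has a favourable sign and is dropped.\<close>
    have "(1 / real q - 1) * S t powr (1 / real q - 1 - 1) * S' t * S' t =
        - ((1 - 1 / real q) * S t powr (1 / real q - 1 - 1) * (S' t)\<^sup>2)"
      by (simp add: power2_eq_square algebra_simps)
    also have "\<dots> \<le> 0"
      using assms(2) by (simp add: mult_nonneg_nonneg)
    finally have "g'' t \<le> (1 / real q) * (S t powr (1 / real q - 1) * S'' t)"
      unfolding g''_def by (intro mult_left_mono) auto
    also have "S'' t = real (2 * q) * real (2 * q - 1) * (\<Sum>m\<in>I. ?v m ^ (2 * (q - 1)) * (y m)\<^sup>2)"
      by (simp add: S''_def sum_distrib_left power2_eq_square mult_ac diff_mult_distrib2)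
    also have "(1 / real q) * (S t powr (1 / real q - 1) * \<dots>) =
        2 * real (2 * q - 1) * (S t powr (1 / real q - 1) * (\<Sum>m\<in>I. ?v m ^ (2 * (q - 1)) * (y m)\<^sup>2))"
      using assms(2) by simp
    also have "\<dots> \<le> 2 * real (2 * q - 1) * (S t powr (1 / real q - 1) * (2 * g t ^ (q - 1) * b\<^sup>2))"
    proof -
      have "(\<Sum>m\<in>I. ?v m ^ (2 * (q - 1)) * (y m)\<^sup>2) \<le> (\<Sum>m\<in>I. ?v m ^ (2 * (q - 1)) * b\<^sup>2)"
        using assms(5)
          by (intro sum_mono mult_left_mono)
            (auto simp: power_mult abs_le_square_iff[symmetric] intro: order_trans[OF _ abs_ge_self])
      also have "\<dots> \<le> 2 * g t ^ (q - 1) * b\<^sup>2"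
        unfolding g_def sum_distrib_right[symmetric]
        by (intro mult_right_mono sum_power_pred_le_smooth_max assms) auto
      finally show ?thesis by (intro mult_left_mono) auto
    qed
    also have "\<dots> = 2 * real (2 * q - 1) * 2 * b\<^sup>2 * (S t powr (1 / real q - 1) * g t ^ (q - 1))"
      by simp
    also have "\<dots> = 2 * (real (4 * q - 2) * b\<^sup>2)"
      using assms(2) smooth_max_power_pred[OF assms(1,2), of I ?v]
      by (simp add: S_def g_def of_nat_diff algebra_simps)
    finally show ?thesis .
  qed
  have "g 1 \<le> g 0 + g' 0 + real (4 * q - 2) * b\<^sup>2"
    by (rule second_order_upper_bound[OF dg dg' bound])
  moreover have "g' 0 = (\<Sum>m\<in>I. smooth_max_deriv \<epsilon> q I u m * y m)"
    using assms(2) by (simp add: g'_def S'_def S_def smooth_max_deriv_def sum_distrib_left mult_ac)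
  ultimately show ?thesis by (simp add: g_def)
qed

section \<open>Martingale differences\<close>

lemma finite_measure_unit_leb: "finite_measure unit_leb"
  by (rule finite_measureI) (simp add: emeasure_restrict_space)

lemma L2_unitD:
  assumes "f \<in> L2_unit"
  shows "f \<in> borel_measurable unit_leb" "integrable unit_leb (\<lambda>x. (f x)\<^sup>2)"
  using assms by (auto simp: L2_unit_def)

lemma L2_unit_mult_integrable:
  assumes "f \<in> L2_unit" "g \<in> L2_unit"
  shows "integrable unit_leb (\<lambda>x. f x * g x)"
proof (rule Bochner_Integration.integrable_bound)
  show "integrable unit_leb (\<lambda>x. (f x)\<^sup>2 + (g x)\<^sup>2)"
    using assms L2_unitD by auto
  show "(\<lambda>x. f x * g x) \<in> borel_measurable unit_leb"
    using assms[THEN L2_unitD(1)] by measurable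
  have "\<bar>f x * g x\<bar> \<le> (f x)\<^sup>2 + (g x)\<^sup>2" for x
    using sum_squares_bound[of "\<bar>f x\<bar>" "\<bar>g x\<bar>"] abs_ge_zero[of "f x * g x"]
    unfolding abs_mult power2_abs by linarith
  then show "AE x in unit_leb. norm (f x * g x) \<le> norm ((f x)\<^sup>2 + (g x)\<^sup>2)"
    by simp
qed

lemma L2_unit_bound:
  assumes "g \<in> L2_unit" "f \<in> borel_measurable unit_leb" "\<And>x. \<bar>f x\<bar> \<le> C * \<bar>g x\<bar>"
  shows "f \<in> L2_unit"
proof -
  have "(f x)\<^sup>2 \<le> C\<^sup>2 * (g x)\<^sup>2" for x
    using power_mono[OF assms(3)[of x], of 2] by (simp add: power_mult_distrib)
  then have "integrable unit_leb (\<lambda>x. (f x)\<^sup>2)"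
    using assms(2) L2_unitD(2)[OF assms(1)]
    by (intro Bochner_Integration.integrable_bound[where g = "\<lambda>x. (f x)\<^sup>2"
          and f = "\<lambda>x. C\<^sup>2 * (g x)\<^sup>2"]) auto
  then show ?thesis using assms(2) by (simp add: L2_unit_def)
qed

lemma L2_unit_cmult:
  assumes "f \<in> L2_unit"
  shows "(\<lambda>x. c * f x) \<in> L2_unit"
  using L2_unitD[OF assms] by (auto simp: L2_unit_def power_mult_distrib)

lemma L2_unit_add:
  assumes "f \<in> L2_unit" "g \<in> L2_unit"
  shows "(\<lambda>x. f x + g x) \<in> L2_unit"
  using L2_unitD[OF assms(1)] L2_unitD[OF assms(2)] L2_unit_mult_integrable[OF assms]
  by (simp add: L2_unit_def power2_sum mult.assoc)

lemma L2_unit_sum: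
  assumes "\<And>i. i \<in> I \<Longrightarrow> f i \<in> L2_unit"
  shows "(\<lambda>x. \<Sum>i\<in>I. f i x) \<in> L2_unit"
  using assms
proof (induction I rule: infinite_finite_induct)
  case (insert i I)
  then show ?case by (simp add: L2_unit_add)
qed (simp_all add: L2_unit_def)

section \<open>Adaptedness to a partition, and orthogonality to the past\<close>

definition constant_on_parts :: "real set set \<Rightarrow> (real \<Rightarrow> real) \<Rightarrow> bool"
  where "constant_on_parts P h \<longleftrightarrow> (\<forall>A\<in>P. \<exists>a. AE x in unit_leb. x \<in> A \<longrightarrow> h x = a)"

text \<open>The second hypothesis says that \<open>H\<close> depends only on the coordinates below
  \<open>k\<close>. Hence only finitely many exceptional null sets have to be united.\<close>

lemma constant_on_parts_fun:
  fixes f :: "nat \<Rightarrow> real \<Rightarrow> real"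
  assumes "\<And>i. i < k \<Longrightarrow> constant_on_parts P (f i)"
    and "\<And>v w. (\<And>i. i < k \<Longrightarrow> v i = w i) \<Longrightarrow> H v = H w"
  shows "constant_on_parts P (\<lambda>x. H (\<lambda>i. f i x))"
  unfolding constant_on_parts_def
proof
  fix A assume "A \<in> P"
  then have "\<forall>i. \<exists>a. i < k \<longrightarrow> (AE x in unit_leb. x \<in> A \<longrightarrow> f i x = a)"
    using assms(1) by (auto simp: constant_on_parts_def)
  then obtain a where a: "\<And>i. i < k \<Longrightarrow> AE x in unit_leb. x \<in> A \<longrightarrow> f i x = a i"
    by metis
  have "AE x in unit_leb. \<forall>i\<in>{..<k}. x \<in> A \<longrightarrow> f i x = a i"
    using a by (intro AE_finite_allI) auto
  then have "AE x in unit_leb. x \<in> A \<longrightarrow> H (\<lambda>i. f i x) = H a"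
    by eventually_elim (auto intro: assms(2))
  then show "\<exists>a. AE x in unit_leb. x \<in> A \<longrightarrow> H (\<lambda>i. f i x) = a" by blast
qed

text \<open>Constancy passes to refinements: a point of a nonempty fine set \<open>B\<close> lies in
  some coarse \<open>A\<close>, and by disjointness the child of \<open>A\<close> containing that
  point is \<open>B\<close> itself.\<close>

lemma constant_on_parts_Suc:
  assumes "unit_filtration \<A>" "constant_on_parts (\<A> n) h"
  shows "constant_on_parts (\<A> (Suc n)) h"
  unfolding constant_on_parts_def
proof
  fix B assume B: "B \<in> \<A> (Suc n)"
  show "\<exists>a. AE x in unit_leb. x \<in> B \<longrightarrow> h x = a"
  proof (cases "B = {}")
    case False
    then obtain x where x: "x \<in> B" by auto
    have part: "unit_partition (\<A> n)" "unit_partition (\<A> (Suc n))"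
      using assms(1) by (auto simp: unit_filtration_def)
    then have "x \<in> \<Union>(\<A> n)" using x B by (auto simp: unit_partition_def)
    then obtain A where A: "A \<in> \<A> n" "x \<in> A" by auto
    then obtain C where C: "C \<subseteq> \<A> (Suc n)" "A = \<Union>C"
      using assms(1) unfolding unit_filtration_def by blast
    then obtain B' where "B' \<in> C" "x \<in> B'" using A by auto
    then have "B' = B"
      using part(2) B x C unfolding unit_partition_def disjoint_def by blast
    then have "B \<subseteq> A" using C \<open>B' \<in> C\<close> by auto
    moreover obtain a where "AE x in unit_leb. x \<in> A \<longrightarrow> h x = a"
      using A assms(2) by (auto simp: constant_on_parts_def)
    ultimately have "AE x in unit_leb. x \<in> B \<longrightarrow> h x = a"
      by (auto elim!: eventually_mono)
    then show ?thesis by blast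
  qed auto
qed

lemma constant_on_parts_mono:
  assumes "unit_filtration \<A>" "m \<le> n" "constant_on_parts (\<A> m) h"
  shows "constant_on_parts (\<A> n) h"
  using assms(2,3) by (induction n rule: dec_induct) (auto intro: constant_on_parts_Suc[OF assms(1)])

text \<open>The pull-out rule for conditional expectations: on each part \<open>h\<close> is a
  scalar, so the product integrates to 0 there, and countable additivity gives the whole
  integral.\<close>

lemma integral_mult_constant_on_parts:
  assumes P: "unit_partition P" and h: "constant_on_parts P h" "h \<in> borel_measurable unit_leb"
    and f: "f \<in> borel_measurable unit_leb" "\<And>A. A \<in> P \<Longrightarrow> (LINT x:A|unit_leb. f x) = 0"
    and int: "integrable unit_leb (\<lambda>x. h x * f x)"
  shows "(\<integral>x. h x * f x \<partial>unit_leb) = 0"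
proof -
  have zero: "(LINT x:A|unit_leb. h x * f x) = 0" if A: "A \<in> P" for A
  proof -
    obtain a where a: "AE x in unit_leb. x \<in> A \<longrightarrow> h x = a"
      using h(1) A by (auto simp: constant_on_parts_def)
    have [measurable]: "A \<in> sets unit_leb" using P A by (auto simp: unit_partition_def)
    have "(LINT x:A|unit_leb. h x * f x) = (LINT x:A|unit_leb. a * f x)"
      unfolding set_lebesgue_integral_def
      using a h(2) f(1) by (intro integral_cong_AE) (auto elim!: eventually_mono simp: indicator_def)
    also have "\<dots> = 0" using f(2)[OF A] by simp
    finally show ?thesis .
  qed
  \<comment> \<open>Lists the parts as a sequence indexed by all naturals; indices that enumerate no
    part yield the empty set, so finite partitions are covered too.\<close>
  define D where "D i = \<Union>{A \<in> P. to_nat_on P A = i}" for i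
  have inj: "inj_on (to_nat_on P) P"
    using P by (intro inj_on_to_nat_on) (simp add: unit_partition_def)
  have D_cases: "D i = {} \<or> D i \<in> P" for i
  proof (cases "\<exists>A\<in>P. to_nat_on P A = i")
    case True
    then obtain A where "A \<in> P" "to_nat_on P A = i" by auto
    then have "D i = A" using inj by (auto simp: D_def inj_on_def)
    then show ?thesis using \<open>A \<in> P\<close> by simp
  qed (auto simp: D_def)
  have "(\<Union>i. D i) = \<Union>P"
    by (auto simp: D_def)
  then have UN: "(\<Union>i. D i) = {0..<1}"
    using P by (simp add: unit_partition_def)
  have "(LINT x:(\<Union>i. D i)|unit_leb. h x * f x) = (\<Sum>i. LINT x:D i|unit_leb. h x * f x)"
  proof (rule lebesgue_integral_countable_add)
    show "D i \<in> sets unit_leb" for i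
      using D_cases[of i] P by (auto simp: unit_partition_def)
    show "D i \<inter> D j = {}" if "i \<noteq> j" for i j
    proof (rule equals0I)
      fix x assume "x \<in> D i \<inter> D j"
      then obtain A B where "A \<in> P" "B \<in> P" "x \<in> A" "x \<in> B" "to_nat_on P A = i" "to_nat_on P B = j"
        by (auto simp: D_def)
      moreover from this have "A = B"
        using P disjointD[of P A B] by (auto simp: unit_partition_def)
      ultimately show False using that by simp
    qed
    show "set_integrable unit_leb (\<Union>i. D i) (\<lambda>x. h x * f x)"
      unfolding UN set_integrable_def using int
      by (subst Bochner_Integration.integrable_cong[where g = "\<lambda>x. h x * f x"]) auto
  qed
  also have "\<dots> = 0"
  proof -
    have "(LINT x:D i|unit_leb. h x * f x) = 0" for i
      using D_cases[of i] zero by (auto simp: set_lebesgue_integral_def)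
    then show ?thesis by simp
  qed
  also have "(LINT x:(\<Union>i. D i)|unit_leb. h x * f x) = (\<integral>x. h x * f x \<partial>unit_leb)"
    unfolding UN set_lebesgue_integral_def by (intro Bochner_Integration.integral_cong) auto
  finally show ?thesis .
qed

text \<open>The first function of a martingale difference may have a nonzero integral, hence the
  assumption for \<open>k = 0\<close>.\<close>

lemma martingale_difference_orthogonal_past:
  assumes \<A>: "unit_filtration \<A>" "martingale_difference_on \<A> f"
    and "\<And>k. f k \<in> L2_unit"
    and H: "\<And>v w. (\<And>i. i < k \<Longrightarrow> v i = w i) \<Longrightarrow> H v = H w" "k = 0 \<Longrightarrow> H (\<lambda>_. 0) = 0"
    and L2: "(\<lambda>x. H (\<lambda>i. f i x)) \<in> L2_unit"
  shows "(\<integral>x. H (\<lambda>i. f i x) * f k x \<partial>unit_leb) = 0"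
proof (cases k)
  case 0
  then have "H (\<lambda>i. f i x) = 0" for x using H(1)[of "\<lambda>i. f i x" "\<lambda>_. 0"] H(2) by simp
  then show ?thesis by simp
next
  case (Suc j)
  have "constant_on_parts (\<A> i) (f i)" for i
    using \<A>(2) unfolding constant_on_parts_def martingale_difference_on_def by blast
  \<comment> \<open>Since \<open>k = Suc j\<close>, all functions before \<open>f k\<close> are
    constant on the sets of \<open>\<A> j\<close>, exactly those over which \<open>f k\<close> has
    integral 0.\<close>
  then have "constant_on_parts (\<A> j) (f i)" if "i < k" for i
    using that Suc constant_on_parts_mono[OF \<A>(1), of i j "f i"] by simp
  then have "constant_on_parts (\<A> j) (\<lambda>x. H (\<lambda>i. f i x))"
    by (rule constant_on_parts_fun) (auto intro: H(1))
  then show ?thesis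
    using \<A> Suc assms(3) L2
    by (intro integral_mult_constant_on_parts[of "\<A> j"] L2_unit_mult_integrable L2_unitD(1))
      (auto simp: unit_filtration_def martingale_difference_on_def)
qed

text \<open>Pythagoras: the partial sum is a function of the past, so the cross term with the next
  function vanishes.\<close>

lemma martingale_difference_integral_square:
  assumes "unit_filtration \<A>" "martingale_difference_on \<A> f" "\<And>k. f k \<in> L2_unit"
  shows "(\<integral>x. (\<Sum>j<N. d j * f j x)\<^sup>2 \<partial>unit_leb) = (\<Sum>j<N. (d j)\<^sup>2 * (\<integral>x. (f j x)\<^sup>2 \<partial>unit_leb))"
proof (induction N)
  case 0
  then show ?case by simp
next
  case (Suc N)
  let ?s = "\<lambda>x. \<Sum>j<N. d j * f j x"
  have s: "?s \<in> L2_unit"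
    by (intro L2_unit_sum L2_unit_cmult assms)
  have "(\<integral>x. ?s x * f N x \<partial>unit_leb) = 0"
    using s by (intro martingale_difference_orthogonal_past[OF assms, where H = "\<lambda>v. \<Sum>j<N. d j * v j"]) auto
  moreover have "(\<integral>x. (\<Sum>j<Suc N. d j * f j x)\<^sup>2 \<partial>unit_leb) =
      (\<integral>x. (?s x)\<^sup>2 + (d N)\<^sup>2 * (f N x)\<^sup>2 + (2 * d N) * (?s x * f N x) \<partial>unit_leb)"
    by (intro Bochner_Integration.integral_cong) (auto simp: power2_sum power_mult_distrib mult_ac)
  moreover have "\<dots> = (\<integral>x. (?s x)\<^sup>2 \<partial>unit_leb) + (d N)\<^sup>2 * (\<integral>x. (f N x)\<^sup>2 \<partial>unit_leb)
      + (2 * d N) * (\<integral>x. ?s x * f N x \<partial>unit_leb)"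
    using L2_unitD(2)[OF s] L2_unitD(2)[OF assms(3)[of N]]
      L2_unit_mult_integrable[OF s assms(3)[of N]]
    by simp
  ultimately show ?case using Suc by simp
qed

section \<open>The maximal inequality\<close>

text \<open>Induction on \<open>N\<close>, integrating the smoothness inequality at each new
  increment. Integrability is carried along with the bound, since the next step integrates the
  previous stage.\<close>

lemma smooth_max_martingale:
  assumes \<A>: "unit_filtration \<A>" "martingale_difference_on \<A> f" "\<And>k. f k \<in> L2_unit"
    and I: "0 < \<epsilon>" "0 < q" "finite I" "card I \<le> 2 ^ q"
    and b: "\<And>m j. m \<in> I \<Longrightarrow> \<bar>a m j\<bar> \<le> b j"
  shows "integrable unit_leb (\<lambda>x. smooth_max \<epsilon> q I (\<lambda>m. \<Sum>j<N. a m j * f j x)) \<and>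
    (\<integral>x. smooth_max \<epsilon> q I (\<lambda>m. \<Sum>j<N. a m j * f j x) \<partial>unit_leb) \<le>
      \<epsilon> + real (4 * q - 2) * (\<Sum>j<N. (b j)\<^sup>2 * (\<integral>x. (f j x)\<^sup>2 \<partial>unit_leb))"
proof (induction N)
  case 0
  interpret finite_measure unit_leb by (rule finite_measure_unit_leb)
  have "measure unit_leb {0..<1} = 1"
    by (simp add: measure_restrict_space)
  then show ?case using I by (simp add: smooth_max_zero)
next
  case (Suc N)
  have fm [measurable]: "f k \<in> borel_measurable unit_leb" for k
    using L2_unitD(1)[OF \<A>(3)] .
  define S where "S n x = smooth_max \<epsilon> q I (\<lambda>m. \<Sum>j<n. a m j * f j x)" for n x
  \<comment> \<open>The derivative at stage \<open>N\<close> as a functional of a whole sequence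
    \<open>v\<close>, reading only the entries below \<open>N\<close>: the form in which
    orthogonality to the past applies.\<close>
  define D where "D m v = smooth_max_deriv \<epsilon> q I (\<lambda>m. \<Sum>j<N. a m j * v j) m" for m and v :: "nat \<Rightarrow> real"
  have S_meas [measurable]: "S n \<in> borel_measurable unit_leb" for n
    unfolding S_def[abs_def] smooth_max_def smooth_sum_def by measurable
  have D_L2: "(\<lambda>x. D m (\<lambda>i. f i x)) \<in> L2_unit" if "m \<in> I" for m
  proof (rule L2_unit_bound[where C = 2 and g = "\<lambda>x. \<Sum>j<N. a m j * f j x"])
    show "(\<lambda>x. \<Sum>j<N. a m j * f j x) \<in> L2_unit"
      by (intro L2_unit_sum L2_unit_cmult \<A>)
    show "(\<lambda>x. D m (\<lambda>i. f i x)) \<in> borel_measurable unit_leb"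
      unfolding D_def smooth_max_deriv_def smooth_sum_def by measurable
  qed (auto simp: D_def intro!: abs_smooth_max_deriv_le I that)
  have D_int: "integrable unit_leb (\<lambda>x. D m (\<lambda>i. f i x) * f N x)" if "m \<in> I" for m
    by (intro L2_unit_mult_integrable D_L2 that \<A>)
  have D_zero: "(\<integral>x. D m (\<lambda>i. f i x) * f N x \<partial>unit_leb) = 0" if "m \<in> I" for m
  proof (rule martingale_difference_orthogonal_past[OF \<A>, of N "D m"])
    show "D m v = D m w" if "\<And>i. i < N \<Longrightarrow> v i = w i" for v w
      using that by (simp add: D_def)
    \<comment> \<open>The derivative vanishes at the origin because \<open>2 * q - 1\<close> is
      positive, so a nonzero mean of the first function does no harm.\<close>
    show "D m (\<lambda>_. 0) = 0" if "N = 0"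
      using I by (simp add: D_def smooth_max_deriv_def)
  qed (rule D_L2[OF that])
  define R where "R x = S N x + (\<Sum>m\<in>I. a m N * (D m (\<lambda>i. f i x) * f N x))
      + real (4 * q - 2) * ((b N)\<^sup>2 * (f N x)\<^sup>2)" for x
  have le: "S (Suc N) x \<le> R x" for x
  proof -
    have "\<bar>a m N * f N x\<bar> \<le> b N * \<bar>f N x\<bar>" if "m \<in> I" for m
      using b[OF that, of N] by (simp add: abs_mult mult_right_mono)
    then show ?thesis
      using smooth_max_two_smooth[OF I, of "\<lambda>m. a m N * f N x" "b N * \<bar>f N x\<bar>"
          "\<lambda>m. \<Sum>j<N. a m j * f j x"]
      by (simp add: S_def R_def D_def mult_ac power_mult_distrib)
  qed
  have S_nonneg: "0 \<le> S n x" for n x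
    unfolding S_def using smooth_max_pos[OF I(1)] by (rule less_imp_le)
  have IH: "integrable unit_leb (S N)"
    "integral\<^sup>L unit_leb (S N) \<le> \<epsilon> + real (4 * q - 2) * (\<Sum>j<N. (b j)\<^sup>2 * (\<integral>x. (f j x)\<^sup>2 \<partial>unit_leb))"
    using Suc by (auto simp: S_def[abs_def])
  have R: "integrable unit_leb R"
    unfolding R_def[abs_def] using IH(1) D_int L2_unitD(2)[OF \<A>(3)] by auto
  have int: "integrable unit_leb (S (Suc N))"
    using le S_nonneg by (intro Bochner_Integration.integrable_bound[OF R])
      (auto intro!: AE_I2 order_trans[OF le abs_ge_self])
  have "integral\<^sup>L unit_leb (S (Suc N)) \<le> integral\<^sup>L unit_leb R"
    by (intro integral_mono int R le)
  also have "\<dots> = integral\<^sup>L unit_leb (S N) + real (4 * q - 2) * ((b N)\<^sup>2 * (\<integral>x. (f N x)\<^sup>2 \<partial>unit_leb))"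
    unfolding R_def[abs_def] using IH(1) D_int D_zero L2_unitD(2)[OF \<A>(3)]
    by (simp add: Bochner_Integration.integral_sum)
  finally show ?case
    using int IH(2) by (simp add: S_def[abs_def] distrib_left)
qed

text \<open>\<open>smooth_max\<close> dominates the squared maximum, and Pythagoras turns the sum of
  increments into the norm of the dominating polynomial. The constant is independent of \<epsilon>,
  which can therefore tend to 0.\<close>

lemma integral_Max_square_le:
  assumes \<A>: "unit_filtration \<A>" "martingale_difference_on \<A> f" "\<And>k. f k \<in> L2_unit"
    and I: "0 < q" "finite I" "I \<noteq> {}" "card I \<le> 2 ^ q"
    and b: "\<And>m j. m \<in> I \<Longrightarrow> \<bar>a m j\<bar> \<le> \<bar>d j\<bar>"
  shows "(\<integral>x. (MAX m\<in>I. \<bar>\<Sum>j<N. a m j * f j x\<bar>)\<^sup>2 \<partial>unit_leb) \<le>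
    real (4 * q - 2) * (\<integral>x. (\<Sum>j<N. d j * f j x)\<^sup>2 \<partial>unit_leb)"
proof (rule field_le_epsilon)
  fix \<epsilon> :: real assume \<epsilon>: "0 < \<epsilon>"
  let ?p = "\<lambda>x m. \<Sum>j<N. a m j * f j x"
  note bound = smooth_max_martingale[OF \<A> \<epsilon> I(1,2,4), of a "\<lambda>j. \<bar>d j\<bar>" N, OF b]
  have "(MAX m\<in>I. \<bar>?p x m\<bar>)\<^sup>2 \<le> smooth_max \<epsilon> q I (?p x)" for x
  proof -
    have "(MAX m\<in>I. \<bar>?p x m\<bar>) \<in> (\<lambda>m. \<bar>?p x m\<bar>) ` I"
      using I by (intro Max_in) auto
    then obtain m where "m \<in> I" "(MAX m\<in>I. \<bar>?p x m\<bar>) = \<bar>?p x m\<bar>" by auto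
    then show ?thesis
      using square_le_smooth_max[OF \<epsilon> I(1,2), of m "?p x"] by simp
  qed
  then have "(\<integral>x. (MAX m\<in>I. \<bar>?p x m\<bar>)\<^sup>2 \<partial>unit_leb) \<le> (\<integral>x. smooth_max \<epsilon> q I (?p x) \<partial>unit_leb)"
    \<comment> \<open>A non-integrable left side would have integral 0 by convention; nonnegativity
      of the majorant covers that case.\<close>
    using bound by (intro integral_mono') (simp_all add: less_imp_le[OF smooth_max_pos[OF \<epsilon>]])
  also have "\<dots> \<le> real (4 * q - 2) * (\<integral>x. (\<Sum>j<N. d j * f j x)\<^sup>2 \<partial>unit_leb) + \<epsilon>"
    using bound by (simp add: martingale_difference_integral_square[OF \<A>])
  finally show "(\<integral>x. (MAX m\<in>I. \<bar>?p x m\<bar>)\<^sup>2 \<partial>unit_leb) \<le>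
    real (4 * q - 2) * (\<integral>x. (\<Sum>j<N. d j * f j x)\<^sup>2 \<partial>unit_leb) + \<epsilon>" .
qed

section \<open>Choice of the exponent and passage to monotonic sequences\<close>

lemma exists_exponent_log_bound:
  fixes n :: nat
  assumes "2 \<le> n"
  obtains q :: nat where "0 < q" "n \<le> 2 ^ q" "real (4 * q - 2) \<le> 9 * log 2 (real n)"
proof
  define q where "q = nat \<lceil>log 2 (real n)\<rceil>"
  have log: "1 \<le> log 2 (real n)"
    using assms by (simp add: le_log_iff)
  have q: "log 2 (real n) \<le> real q" "real q \<le> log 2 (real n) + 1"
    using log by (auto simp: q_def)
  show "0 < q" using q(1) log by (cases q) auto
  have "real n \<le> 2 powr real q"
    using q(1) assms by (simp add: log_le_iff)
  then show "n \<le> 2 ^ q"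
    by (simp add: powr_realpow)
  \<comment> \<open>Rounding up gives at most \<open>4 * log 2 n + 2\<close>, hence at most
    \<open>6 * log 2 n\<close> as the logarithm is at least 1; the looser 9 has the integer square
    root 3.\<close>
  show "real (4 * q - 2) \<le> 9 * log 2 (real n)"
    using q(2) log \<open>0 < q\<close> by (simp add: of_nat_diff)
qed

lemma monotonic_polys_ratio_le:
  assumes "martingale_difference \<Phi>" "\<And>k. \<Phi> k \<in> L2_unit" "2 \<le> n" "p \<in> monotonic_polys \<Phi> n"
  shows "L2_unit_norm (\<lambda>x. MAX m\<in>{1..n}. \<bar>p m x\<bar>) / L2_unit_norm (p n) \<le> 3 * sqrt (log 2 (real n))"
proof -
  obtain \<A> where \<A>: "unit_filtration \<A>" "martingale_difference_on \<A> \<Phi>"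
    using assms(1) by (auto simp: martingale_difference_def)
  obtain G c where fin: "\<And>k. k \<in> {1..n} \<Longrightarrow> finite (G k)"
    and mono: "\<And>k. k \<in> {1..<n} \<Longrightarrow> G k \<subseteq> G (Suc k)"
    and p: "\<And>k. k \<in> {1..n} \<Longrightarrow> p k = (\<lambda>x. \<Sum>j\<in>G k. c j * \<Phi> j x)"
    using assms(4) unfolding monotonic_polys_def mem_Collect_eq by blast
  have sub: "G k \<subseteq> G n" if "k \<in> {1..n}" for k
  proof -
    have "k \<le> n" using that by simp
    then show ?thesis
    proof (induction rule: inc_induct)
      case (step i)
      then show ?case using mono[of i] that by auto
    qed simp
  qed
  obtain N where N: "G n \<subseteq> {..<N}"
    using finite_nat_iff_bounded[of "G n"] fin[of n] assms(3) by auto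
  obtain q where q: "0 < q" "n \<le> 2 ^ q" "real (4 * q - 2) \<le> 9 * log 2 (real n)"
    using exists_exponent_log_bound[OF assms(3)] .
  \<comment> \<open>Padding with zeros puts all polynomials on the index range below
    \<open>N\<close>; nestedness of the sets gives
    \<open>\<bar>a m j\<bar> \<le> \<bar>a n j\<bar>\<close>, so row \<open>n\<close>
    dominates.\<close>
  define a where "a m j = (if j \<in> G m then c j else 0)" for m j
  have p_eq: "p m x = (\<Sum>j<N. a m j * \<Phi> j x)" if "m \<in> {1..n}" for m x
  proof -
    have "(\<Sum>j<N. a m j * \<Phi> j x) = (\<Sum>j\<in>G m. a m j * \<Phi> j x)"
      using sub[OF that] N by (intro sum.mono_neutral_right) (auto simp: a_def)
    then show ?thesis by (simp add: p[OF that] a_def)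
  qed
  have "(\<integral>x. (MAX m\<in>{1..n}. \<bar>\<Sum>j<N. a m j * \<Phi> j x\<bar>)\<^sup>2 \<partial>unit_leb) \<le>
      real (4 * q - 2) * (\<integral>x. (\<Sum>j<N. a n j * \<Phi> j x)\<^sup>2 \<partial>unit_leb)"
    using q assms(3) sub by (intro integral_Max_square_le[OF \<A> assms(2)]) (auto simp: a_def)
  also have "\<dots> \<le> 9 * log 2 (real n) * (\<integral>x. (\<Sum>j<N. a n j * \<Phi> j x)\<^sup>2 \<partial>unit_leb)"
    by (intro mult_right_mono q(3)) auto
  finally have "(\<integral>x. (MAX m\<in>{1..n}. \<bar>p m x\<bar>)\<^sup>2 \<partial>unit_leb) \<le>
      9 * log 2 (real n) * (\<integral>x. (p n x)\<^sup>2 \<partial>unit_leb)"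
    using assms(3) by (simp add: p_eq cong: image_cong_simp)
  then have "L2_unit_norm (\<lambda>x. MAX m\<in>{1..n}. \<bar>p m x\<bar>) \<le>
      sqrt (9 * log 2 (real n) * (\<integral>x. (p n x)\<^sup>2 \<partial>unit_leb))"
    unfolding L2_unit_norm_def by (rule real_sqrt_le_mono)
  also have "\<dots> = 3 * sqrt (log 2 (real n)) * L2_unit_norm (p n)"
    unfolding L2_unit_norm_def real_sqrt_mult by simp
  finally have le: "L2_unit_norm (\<lambda>x. MAX m\<in>{1..n}. \<bar>p m x\<bar>) \<le> \<dots>" .
  have nonneg: "0 \<le> L2_unit_norm (p n)" "0 \<le> log 2 (real n)"
    using assms(3) by (auto simp: L2_unit_norm_def)
  show ?thesis
  \<comment> \<open>With a zero denominator the quotient is 0 by convention, below the nonnegative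
    right side.\<close>
  proof (cases "L2_unit_norm (p n) = 0")
    case False
    then show ?thesis using le nonneg by (simp add: pos_divide_le_eq)
  qed (use nonneg in simp)
qed

theorem theorem1p1:
  shows "\<exists>c::real. c > 0 \<and>
    (\<forall>\<Phi> :: nat \<Rightarrow> real \<Rightarrow> real.
      martingale_difference \<Phi> \<longrightarrow>
      (\<forall>k. \<Phi> k \<in> L2_unit) \<longrightarrow>
      (\<forall>k. \<not> (AE x in unit_leb. \<Phi> k x = 0)) \<longrightarrow>
      (\<forall>n::nat. n \<ge> 2 \<longrightarrow> maximal_const n \<Phi> \<le> ereal (c * sqrt (log 2 (real n)))))"
  unfolding maximal_const_def
  by (intro exI[of _ 3] conjI allI impI SUP_least)
    (auto simp del: One_nat_def intro: monotonic_polys_ratio_le)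

end
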